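(* We have the equality $d_{BM}(\mathcal{C}_4, \mathcal{C}_4^* ) = 2$.
   Context: A convex body in $\mathbb{R}^n$ ($n\ge 2$) is a compact convex set with non-empty interior. For convex bodies $K, L \subseteq \mathbb{R}^n$ the Banach-Mazur distance is $$d_{BM}(K,L) = \inf \{r >0 : K+ u \subseteq T(L+v) \subseteq r(K+u) \},$$ where the infimum is taken over all invertible linear operators $T : \mathbb{R}^n \to \mathbb{R}^n$ and vectors $u, v \in \mathbb{R}^n$. Here $\mathcal{C}_n = [-1,1]^n$ is the unit cube (the unit ball of the maximum norm) in $\mathbb{R}^n$ and $\mathcal{C}_n^* = \{x \in \mathbb{R}^n : |x_1| + \dots + |x_n| \leq 1\}$ is its dual, the cross-polytope. *)

theory Defs
  imports "HOL-Analysis.Analysis"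
begin

(* Meant for compact convex sets with non-empty interior. For such K and L the set of
   admissible r is non-empty and bounded below, so the conditionally complete Inf on the
   reals is the true infimum. *)
definition banach_mazur :: "(real ^ 'n) set \<Rightarrow> (real ^ 'n) set \<Rightarrow> real" where
  "banach_mazur K L =
     Inf {r. r > 0 \<and>
            (\<exists>T u v. linear T \<and> bij T \<and>
               (\<lambda>x. x + u) ` K \<subseteq> T ` (\<lambda>x. x + v) ` L \<and>
               T ` (\<lambda>x. x + v) ` L \<subseteq> (\<lambda>x. r *\<^sub>R x) ` (\<lambda>x. x + u) ` K)}"

definition cube :: "(real ^ 'n) set" where
  "cube = {x. \<forall>i. x $ i \<in> {-1..1}}"

definition cross_polytope :: "(real ^ 'n) set" where
  "cross_polytope = {x. (\<Sum>i\<in>UNIV. \<bar>x $ i\<bar>) \<le> 1}"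

end

theory Submission
  imports Defs
begin

text \<open>
  The value 2 is attained by twice a Hadamard matrix of order 4. For the lower bound, central
  symmetry of both bodies removes the translations, so that the cube lies in the image of the
  cross-polytope under a linear map \<open>T\<close>, and this image lies in \<open>r\<close> times the cube. The latter says
  that the matrix of \<open>T\<close> has entries of absolute value at most \<open>r\<close>; the former that
  \<open>\<parallel>v\<parallel>\<^sub>1 \<le> \<parallel>T v\<parallel>\<^sub>\<infinity>\<close> for all \<open>v\<close>. After division by \<open>r\<close>, the bound \<open>r \<ge> 2\<close> follows from a
  statement about real \<open>4 \<times> 4\<close> matrices (\<open>exists_vector_half_norm\<close>): if all entries lie in
  \<open>[-1, 1]\<close>, then some \<open>v \<noteq> 0\<close> satisfies \<open>\<parallel>T v\<parallel>\<^sub>\<infinity> \<le> \<parallel>v\<parallel>\<^sub>1 / 2\<close>.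

  The first candidates for \<open>v\<close> are the sign vectors, for which the requirement reads
  \<open>\<bar>a \<bullet> v\<bar> \<le> 2\<close> for each row \<open>a\<close>. A row cannot violate it for two sign vectors that differ in
  exactly two coordinates. Up to sign there are eight sign vectors; they fall into two parity classes of
  four, and distinct members of a class differ in exactly two coordinates. So a row excludes at most one
  vector of each class, and the four rows either leave some sign vector available, or
  every row excludes exactly one vector of each class and no vector is excluded twice
  (\<open>row_blocks_unique_flip\<close>, \<open>blocked_edge\<close>).

  In the second case each row \<open>a\<^sub>i\<close> excludes a sign vector \<open>w\<^sub>i\<close> and the one that differs from it only
  in some coordinate \<open>j\<^sub>i\<close>. This forces \<open>a\<^sub>i\<close> to have \<open>\<ell>\<^sub>1\<close> distance below 1 from the vector obtained from \<open>w\<^sub>i\<close> by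
  putting 0 at \<open>j\<^sub>i\<close>. Take the row \<open>k\<close> for which this distance is largest, and take \<open>v\<close> to be \<open>w\<^sub>k\<close>
  with its entry at \<open>j\<^sub>k\<close> stretched by a factor \<open>X\<close>. The sign at \<open>j\<^sub>k\<close> can be chosen such that
  stretching decreases \<open>a\<^sub>k \<bullet> v\<close>, and \<open>X\<close> is chosen such that row \<open>k\<close> satisfies its requirement with
  equality. Then \<open>1 \<le> X \<le> 3 - 2 \<eta>\<close>, where \<open>\<eta>\<close> is the distance for row \<open>k\<close>. This suffices for
  the other rows, because their distances are at most \<open>\<eta>\<close> and none of them excludes \<open>w\<^sub>k\<close> with
  either sign at \<open>j\<^sub>k\<close>
  (\<open>stretched_same_coordinate_le\<close>, \<open>stretched_other_coordinate_le\<close>).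
\<close>

section \<open>Sign vectors excluded by a row\<close>

definition sign_vector :: "(4 \<Rightarrow> real) \<Rightarrow> bool" where
  "sign_vector w \<longleftrightarrow> (\<forall>j. \<bar>w j\<bar> = 1)"

definition dot :: "(4 \<Rightarrow> real) \<Rightarrow> (4 \<Rightarrow> real) \<Rightarrow> real" where
  "dot a w = (\<Sum>j\<in>UNIV. a j * w j)"

definition flip :: "(4 \<Rightarrow> real) \<Rightarrow> 4 \<Rightarrow> 4 \<Rightarrow> real" where
  "flip w m = w(m := - w m)"

text \<open>The threshold 2 is half the \<open>\<ell>\<^sub>1\<close> norm of a sign vector.\<close>

definition blocks :: "(4 \<Rightarrow> real) \<Rightarrow> (4 \<Rightarrow> real) \<Rightarrow> bool" where
  "blocks a w \<longleftrightarrow> \<bar>dot a w\<bar> > 2"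

text \<open>
  For \<open>a\<close> in the unit cube and a sign vector \<open>w\<close> this is the \<open>\<ell>\<^sub>1\<close> distance between \<open>a\<close> and
  \<open>w(j := 0)\<close>, since \<open>\<bar>w l - a l\<bar> = 1 - a l * w l\<close>.
\<close>

definition deviation :: "(4 \<Rightarrow> real) \<Rightarrow> (4 \<Rightarrow> real) \<Rightarrow> 4 \<Rightarrow> real" where
  "deviation a w j = \<bar>a j\<bar> + (\<Sum>l\<in>UNIV - {j}. 1 - a l * w l)"

lemma four_coordinates:
  fixes j j' :: 4
  assumes "j \<noteq> j'"
  obtains p q where "distinct [j, j', p, q]" "UNIV = {j, j', p, q}"
proof -
  have "card (UNIV - {j, j'}) = 2"
    using assms by (simp add: card_Diff_subset)
  then obtain p q where pq: "UNIV - {j, j'} = {p, q}" "p \<noteq> q"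
    by (auto simp: card_2_iff)
  then have "UNIV = {j, j', p, q}" by blast
  moreover have "distinct [j, j', p, q]" using pq assms by auto
  ultimately show thesis using that by blast
qed

lemma sign_vector_flip: "sign_vector w \<Longrightarrow> sign_vector (flip w m)"
  by (simp add: sign_vector_def flip_def)

lemma flip_flip [simp]: "flip (flip w m) m = w"
  by (simp add: flip_def)

lemma abs_mult_sign_vector:
  assumes "\<forall>j. \<bar>a j\<bar> \<le> 1" "sign_vector w"
  shows "\<bar>a j * w j\<bar> \<le> 1"
  using assms by (simp add: sign_vector_def abs_mult)

text \<open>
  Two such flips differ at \<open>m\<close> and \<open>m'\<close> only. Write \<open>S\<close> for the contribution of the two common
  coordinates and \<open>D\<close>, \<open>-D\<close> for that of the others; then \<open>\<bar>S\<bar>, \<bar>D\<bar> \<le> 2\<close>, and the smaller of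
  \<open>\<bar>S + D\<bar>\<close> and \<open>\<bar>S - D\<bar>\<close> is \<open>\<bar>\<bar>S\<bar> - \<bar>D\<bar>\<bar> \<le> 2\<close>.
\<close>

lemma not_blocks_two_flips:
  assumes a: "\<forall>j. \<bar>a j\<bar> \<le> 1" and b: "sign_vector b" and "m \<noteq> m'"
    and "blocks a (flip b m)"
  shows "\<not> blocks a (flip b m')"
proof -
  obtain p q where d: "distinct [m, m', p, q]" and U: "UNIV = {m, m', p, q}"
    using four_coordinates[OF \<open>m \<noteq> m'\<close>] .
  note le = abs_mult_sign_vector[OF a b]
  have 1: "dot a (flip b m) = - (a m * b m) + a m' * b m' + a p * b p + a q * b q"
    unfolding dot_def U using d by (auto simp: flip_def)
  have 2: "dot a (flip b m') = a m * b m - a m' * b m' + a p * b p + a q * b q"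
    unfolding dot_def U using d by (auto simp: flip_def)
  show ?thesis
    using assms(4) le[THEN abs_le_D1, of m] le[THEN abs_le_D2, of m]
      le[THEN abs_le_D1, of m'] le[THEN abs_le_D2, of m']
      le[THEN abs_le_D1, of p] le[THEN abs_le_D2, of p]
      le[THEN abs_le_D1, of q] le[THEN abs_le_D2, of q]
    unfolding blocks_def 1 2 by linarith
qed

text \<open>
  The four flips of \<open>b\<close> represent one parity class of sign vectors up to sign. Choosing a blocking
  row for each of them is injective, hence a bijection between the four flips and the four rows.
\<close>

lemma row_blocks_unique_flip:
  fixes T :: "4 \<Rightarrow> 4 \<Rightarrow> real"
  assumes T: "\<And>i. \<forall>j. \<bar>T i j\<bar> \<le> 1"
    and all: "\<And>w. sign_vector w \<Longrightarrow> \<exists>i. blocks (T i) w"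
    and b: "sign_vector b"
  obtains m where "blocks (T k) (flip b m)" "\<And>i. i \<noteq> k \<Longrightarrow> \<not> blocks (T i) (flip b m)"
proof -
  define g where "g m = (SOME i. blocks (T i) (flip b m))" for m
  have g: "blocks (T (g m)) (flip b m)" for m
    unfolding g_def by (rule someI_ex) (rule all[OF sign_vector_flip[OF b]])
  have "inj g"
  proof (rule injI, rule ccontr)
    fix m m' assume "g m = g m'" "m \<noteq> m'"
    then show False
      using not_blocks_two_flips[OF T b, of m m' "g m"] g[of m] g[of m'] by metis
  qed
  then have surj: "surj g" by (simp add: finite_UNIV_inj_surj)
  then obtain m where m: "k = g m" by (metis surjD)
  have "\<not> blocks (T i) (flip b m)" if "i \<noteq> k" for i
  proof -
    obtain m' where m': "i = g m'" using surj by (metis surjD)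
    then have "m' \<noteq> m" using that m by auto
    then show ?thesis using not_blocks_two_flips[OF T b _ g, of m' m] m' by auto
  qed
  then show thesis using that m g by blast
qed

lemma dot_flip: "dot a (flip w m) = dot a w - 2 * (a m * w m)"
  unfolding dot_def by (simp add: sum.remove[of UNIV m] flip_def cong: sum.cong_simp)

text \<open>
  The smaller of the two scalar products is \<open>3 - deviation a w j\<close>: the entry at \<open>j\<close> counts
  against it, and the other three entries contribute 3 minus their defects.
\<close>

lemma deviation_lt_1_if_blocks:
  assumes w: "sign_vector w" and "dot a w > 2" "dot a (flip w j) > 2"
  shows "deviation a w j < 1"
proof -
  have "card (UNIV - {j}) = 3" by (simp add: card_Diff_subset)
  then have S: "(\<Sum>l\<in>UNIV - {j}. 1 - a l * w l) = 3 - (\<Sum>l\<in>UNIV - {j}. a l * w l)"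
    by (simp add: sum_subtractf)
  have 1: "dot a w = a j * w j + (\<Sum>l\<in>UNIV - {j}. a l * w l)"
    unfolding dot_def by (simp add: sum.remove[of UNIV j])
  have "\<bar>a j * w j\<bar> = \<bar>a j\<bar>" using w by (simp add: sign_vector_def abs_mult)
  then show ?thesis
    using assms(2,3) unfolding deviation_def S dot_flip 1 by linarith
qed

text \<open>
  Apply the previous bijection twice: first to find a vector \<open>v\<close> blocked by row \<open>k\<close> alone, then with
  \<open>v\<close> itself as base point to find a flip of \<open>v\<close> blocked by row \<open>k\<close> alone. The sign conditions are
  normalisations, reached by replacing \<open>v\<close> by \<open>-v\<close> and by exchanging the two vectors.
\<close>

lemma blocked_edge:
  fixes T :: "4 \<Rightarrow> 4 \<Rightarrow> real"
  assumes T: "\<And>i. \<forall>j. \<bar>T i j\<bar> \<le> 1"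
    and all: "\<And>w. sign_vector w \<Longrightarrow> \<exists>i. blocks (T i) w"
  shows "\<exists>w j. sign_vector w \<and> dot (T k) w > 2 \<and> dot (T k) (flip w j) > 2 \<and> T k j * w j \<le> 0 \<and>
      (\<forall>i. i \<noteq> k \<longrightarrow> \<not> blocks (T i) w \<and> \<not> blocks (T i) (flip w j))"
proof -
  let ?Q = "\<lambda>w j. sign_vector w \<and> (\<forall>i. i \<noteq> k \<longrightarrow> \<not> blocks (T i) w \<and> \<not> blocks (T i) (flip w j))"
  have "sign_vector (\<lambda>_. 1)" by (simp add: sign_vector_def)
  from row_blocks_unique_flip[OF T all this, of k] obtain v
    where v: "sign_vector v" "blocks (T k) v" "\<And>i. i \<noteq> k \<Longrightarrow> \<not> blocks (T i) v"
    by (metis \<open>sign_vector (\<lambda>_. 1)\<close> sign_vector_flip)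
  from row_blocks_unique_flip[OF T all v(1), of k] obtain j
    where j: "blocks (T k) (flip v j)" "\<And>i. i \<noteq> k \<Longrightarrow> \<not> blocks (T i) (flip v j)"
    by metis
  have le: "\<bar>T k j * v j\<bar> \<le> 1" by (rule abs_mult_sign_vector[OF T v(1)])
  \<comment> \<open>Both scalar products have the same sign, since they exceed 2 in absolute value and differ by at most 2.\<close>
  have "\<exists>w. ?Q w j \<and> dot (T k) w > 2 \<and> dot (T k) (flip w j) > 2"
  proof (cases "dot (T k) v > 2")
    case True
    then show ?thesis
      using le v j unfolding blocks_def dot_flip by (intro exI[of _ v]) auto
  next
    case False
    have neg: "dot a (\<lambda>l. - w l) = - dot a w" for a w
      by (simp add: dot_def sum_negf)
    have "sign_vector (\<lambda>l. - v l)" using v by (simp add: sign_vector_def)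
    then show ?thesis
      using False le v j unfolding blocks_def dot_flip
      by (intro exI[of _ "\<lambda>l. - v l"]) (auto simp: neg abs_minus_commute)
  qed
  then obtain w where w: "?Q w j" "dot (T k) w > 2" "dot (T k) (flip w j) > 2" by blast
  show ?thesis
  proof (cases "T k j * w j \<le> 0")
    case True
    then show ?thesis using w by blast
  next
    case False
    then have "T k j * flip w j j \<le> 0" by (simp add: flip_def)
    then show ?thesis
      using w sign_vector_flip[of w j] by (intro exI[of _ "flip w j"] exI[of _ j]) simp
  qed
qed

section \<open>Stretching a sign vector in one coordinate\<close>

definition stretch :: "real \<Rightarrow> (4 \<Rightarrow> real) \<Rightarrow> 4 \<Rightarrow> 4 \<Rightarrow> real" where
  "stretch X w j = w(j := X * w j)"

lemma dot_stretch: "dot a (stretch X w j) = dot a w + (X - 1) * (a j * w j)"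
  unfolding dot_def
  by (simp add: sum.remove[of UNIV j] stretch_def algebra_simps cong: sum.cong_simp)

text \<open>
  The next two lemmas treat a row \<open>a\<close> close to \<open>w'(j' := 0)\<close> that does not block \<open>w\<close>,
  in the cases \<open>j' = j\<close> and \<open>j' \<noteq> j\<close>. The number \<open>X + 3\<close> is the \<open>\<ell>\<^sub>1\<close> norm of
  the stretched vector.

  If \<open>j' = j\<close>, then \<open>w\<close> agrees with \<open>\<plusminus> w'\<close> on at most two of the three other coordinates, as
  otherwise \<open>a\<close> would block \<open>w\<close>. So these three coordinates contribute at most 1 plus the defects of
  \<open>a\<close> there, and the stretched one contributes at most \<open>X * \<bar>a j\<bar>\<close>. In total this is at most
  \<open>1 + X * \<eta>\<close>, and \<open>X * (2 * \<eta> - 1) \<le> 1\<close> by the bound on \<open>X\<close>.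
\<close>

lemma stretched_same_coordinate_le:
  assumes a: "\<forall>l. \<bar>a l\<bar> \<le> 1" and w': "sign_vector w'" and w: "sign_vector w"
    and dev: "deviation a w' j \<le> \<eta>" "\<eta> < 1"
    and nb: "\<not> blocks a w"
    and X: "1 \<le> X" "X \<le> 3 - 2 * \<eta>"
  shows "\<bar>dot a (stretch X w j)\<bar> \<le> (X + 3) / 2"
proof -
  have "j \<noteq> j + 1" by simp
  then obtain p q where d: "distinct [j, j + 1, p, q]" and U: "UNIV = {j, j + 1, p, q}"
    using four_coordinates by blast
  obtain r where d: "distinct [j, r, p, q]" and U: "UNIV = {j, r, p, q}"
    using d U by blast
  have U': "UNIV - {j} = {r, p, q}" unfolding U using d by auto
  define t where "t l = a l * w' l" for l
  have t: "\<bar>t l\<bar> \<le> 1" for l unfolding t_def by (rule abs_mult_sign_vector[OF a w'])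
  have aw: "a l * w l = t l \<or> a l * w l = - t l" for l
  proof -
    have "w l = w' l \<or> w l = - w' l"
      using w w' unfolding sign_vector_def by (metis abs_eq_iff)
    then show ?thesis by (auto simp: t_def)
  qed
  have s: "\<bar>a j * w j\<bar> = \<bar>a j\<bar>" using w by (simp add: sign_vector_def abs_mult)
  have D: "deviation a w' j = \<bar>a j\<bar> + (1 - t r) + (1 - t p) + (1 - t q)"
    unfolding deviation_def U' using d by (simp add: t_def)
  let ?R = "a r * w r + a p * w p + a q * w q"
  have dw: "dot a w = a j * w j + ?R"
    unfolding dot_def U using d by simp
  have R: "\<bar>?R\<bar> \<le> 1 + (\<eta> - \<bar>a j\<bar>)"
  proof -
    have n: "a j * w j + ?R \<le> 2" "- 2 \<le> a j * w j + ?R"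
      using nb unfolding blocks_def dw by linarith+
    have s': "a j * w j \<le> \<bar>a j\<bar>" "- \<bar>a j\<bar> \<le> a j * w j" using s by linarith+
    show ?thesis
      using aw[of r] aw[of p] aw[of q] n s' dev[unfolded D]
        t[THEN abs_le_D1, of r] t[THEN abs_le_D1, of p] t[THEN abs_le_D1, of q]
      by (intro abs_leI; elim disjE; linarith)
  qed
  have "\<bar>X * (a j * w j) + ?R\<bar> \<le> X * \<bar>a j\<bar> + (1 + (\<eta> - \<bar>a j\<bar>))"
    using R s X(1) abs_triangle_ineq[of "X * (a j * w j)" ?R] abs_mult[of X "a j * w j"]
    by simp
  also have "\<dots> = 1 + \<eta> + (X - 1) * \<bar>a j\<bar>" by (simp add: algebra_simps)
  also have "\<dots> \<le> 1 + \<eta> + (X - 1) * \<eta>"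
  proof -
    have "\<bar>a j\<bar> \<le> \<eta>" using dev t[of r] t[of p] t[of q] unfolding D by linarith
    then show ?thesis using X(1) by (simp add: mult_left_mono)
  qed
  also have "\<dots> \<le> (X + 3) / 2"
  proof -
    have "X * (2 * \<eta> - 1) \<le> 1"
    proof (cases "2 * \<eta> - 1 \<le> 0")
      case True
      then have "X * (2 * \<eta> - 1) \<le> 0" using X(1) by (simp add: mult_nonneg_nonpos)
      then show ?thesis by simp
    next
      case False
      then have "X * (2 * \<eta> - 1) \<le> (3 - 2 * \<eta>) * (2 * \<eta> - 1)"
        using X(2) by (intro mult_right_mono) auto
      \<comment> \<open>The maximum over \<open>\<eta>\<close>, attained at \<open>\<eta> = 1\<close>, is exactly 1.\<close>
      also have "\<dots> = 1 - (2 * \<eta> - 2)\<^sup>2" by (simp add: power2_eq_square algebra_simps)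
      also have "\<dots> \<le> 1" by simp
      finally show ?thesis .
    qed
    then show ?thesis by (simp add: algebra_simps)
  qed
  finally show ?thesis
    unfolding dot_stretch dw by (simp add: algebra_simps)
qed

text \<open>
  If \<open>j' \<noteq> j\<close>, then the signs of \<open>w\<close> and \<open>w'\<close> agree on exactly one of the two coordinates \<open>p\<close>, \<open>q\<close>
  other than \<open>j\<close> and \<open>j'\<close>: otherwise one of the two choices of the sign at \<open>j\<close> would give a vector
  agreeing with \<open>w'\<close> or \<open>-w'\<close> on all three large entries of \<open>a\<close>, and \<open>a\<close> would block it. So \<open>p\<close> and
  \<open>q\<close> cancel up to the defects of \<open>a\<close>, and what remains is at most \<open>X + \<eta>\<close>.
\<close>

lemma stretched_other_coordinate_le:
  assumes a: "\<forall>l. \<bar>a l\<bar> \<le> 1" and w': "sign_vector w'" and w: "sign_vector w"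
    and dev: "deviation a w' j' \<le> \<eta>" "\<eta> < 1" and "j \<noteq> j'"
    and nb: "\<not> blocks a w" "\<not> blocks a (flip w j)"
    and X: "1 \<le> X" "X \<le> 3 - 2 * \<eta>"
  shows "\<bar>dot a (stretch X w j)\<bar> \<le> (X + 3) / 2"
proof -
  obtain p q where d: "distinct [j, j', p, q]" and U: "UNIV = {j, j', p, q}"
    using four_coordinates[OF \<open>j \<noteq> j'\<close>] .
  have U': "UNIV - {j'} = {j, p, q}" unfolding U using d by auto
  define t where "t l = a l * w' l" for l
  have t: "\<bar>t l\<bar> \<le> 1" for l unfolding t_def by (rule abs_mult_sign_vector[OF a w'])
  have aw: "a l * w l = t l \<or> a l * w l = - t l" for l
  proof -
    have "w l = w' l \<or> w l = - w' l"
      using w w' unfolding sign_vector_def by (metis abs_eq_iff)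
    then show ?thesis by (auto simp: t_def)
  qed
  have s: "\<bar>a j' * w j'\<bar> = \<bar>a j'\<bar>" using w by (simp add: sign_vector_def abs_mult)
  have D: "deviation a w' j' = \<bar>a j'\<bar> + (1 - t j) + (1 - t p) + (1 - t q)"
    unfolding deviation_def U' using d by (simp add: t_def)
  let ?R = "a j' * w j' + a p * w p + a q * w q"
  have dw: "dot a w = a j * w j + ?R"
    unfolding dot_def U using d by simp
  have R: "\<bar>?R\<bar> \<le> \<eta>"
  proof -
    have n: "a j * w j + ?R \<le> 2" "- 2 \<le> a j * w j + ?R"
      "- (a j * w j) + ?R \<le> 2" "- 2 \<le> - (a j * w j) + ?R"
      using nb unfolding blocks_def dot_flip dw by linarith+
    have s': "a j' * w j' \<le> \<bar>a j'\<bar>" "- \<bar>a j'\<bar> \<le> a j' * w j'" using s by linarith+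
    show ?thesis
      using aw[of j] aw[of p] aw[of q] n s' dev[unfolded D]
        t[THEN abs_le_D1, of j] t[THEN abs_le_D1, of p] t[THEN abs_le_D1, of q]
      by (intro abs_leI; elim disjE; linarith)
  qed
  have "\<bar>X * (a j * w j)\<bar> \<le> X"
    using abs_mult_sign_vector[OF a w, of j] X(1) by (simp add: abs_mult mult_left_le)
  then have "\<bar>X * (a j * w j) + ?R\<bar> \<le> X + \<eta>" using R by linarith
  also have "\<dots> \<le> (X + 3) / 2" using X(2) by (simp add: field_simps)
  finally show ?thesis
    unfolding dot_stretch dw by (simp add: algebra_simps)
qed

section \<open>Contraction by half\<close>

text \<open>
  Equivalently, every real \<open>4 \<times> 4\<close> matrix with entries in \<open>[-1, 1]\<close> lies within entrywise
  distance \<open>1 / 2\<close> of a singular one. The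
  constant \<open>1 / 2\<close> is optimal, as the Hadamard matrix shows.
\<close>

lemma exists_vector_half_norm:
  fixes T :: "4 \<Rightarrow> 4 \<Rightarrow> real"
  assumes T: "\<And>i. \<forall>j. \<bar>T i j\<bar> \<le> 1"
  obtains v where "(\<Sum>j\<in>UNIV. \<bar>v j\<bar>) > 0" "\<And>i. \<bar>dot (T i) v\<bar> \<le> (\<Sum>j\<in>UNIV. \<bar>v j\<bar>) / 2"
proof (cases "\<exists>w. sign_vector w \<and> (\<forall>i. \<not> blocks (T i) w)")
  case True
  then obtain w where w: "sign_vector w" "\<And>i. \<not> blocks (T i) w" by blast
  have "(\<Sum>j\<in>UNIV. \<bar>w j\<bar>) = 4" using w(1) by (simp add: sign_vector_def)
  then show thesis using w(2) by (intro that[of w]) (auto simp: blocks_def not_less)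
next
  case False
  then have all: "\<exists>i. blocks (T i) w" if "sign_vector w" for w using that by blast
  obtain w j where wj: "\<And>k. sign_vector (w k)" "\<And>k. dot (T k) (w k) > 2"
      "\<And>k. dot (T k) (flip (w k) (j k)) > 2" "\<And>k. T k (j k) * w k (j k) \<le> 0"
      "\<And>k i. i \<noteq> k \<Longrightarrow> \<not> blocks (T i) (w k)"
      "\<And>k i. i \<noteq> k \<Longrightarrow> \<not> blocks (T i) (flip (w k) (j k))"
    using blocked_edge[OF T all] by metis
  define dev where "dev k = deviation (T k) (w k) (j k)" for k
  have "\<exists>k. \<forall>i. dev i \<le> dev k"
  proof -
    have "Max (range dev) \<in> range dev" by (intro Max_in) auto
    then obtain k where "Max (range dev) = dev k" by blast
    then show ?thesis by (metis Max_ge finite_imageI finite rangeI)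
  qed
  then obtain k where k: "\<And>i. dev i \<le> dev k" by blast
  define \<eta> s where "\<eta> = dev k" and "s = \<bar>T k (j k)\<bar>"
  \<comment> \<open>This \<open>X\<close> solves \<open>3 - (\<eta> - s) - s * X = (X + 3) / 2\<close>, which makes row \<open>k\<close> tight.\<close>
  define X where "X = (3 - 2 * (\<eta> - s)) / (1 + 2 * s)"
  have \<eta>: "\<eta> < 1" unfolding \<eta>_def dev_def by (rule deviation_lt_1_if_blocks[OF wj(1-3)])
  have s0: "s \<ge> 0" by (simp add: s_def)
  have X1: "1 \<le> X" unfolding X_def using \<eta> s0 by (simp add: field_simps)
  have X3: "X \<le> 3 - 2 * \<eta>"
  proof -
    have "s * \<eta> \<le> s" using \<eta> s0 by (simp add: mult_left_le)
    then show ?thesis unfolding X_def using s0 by (simp add: field_simps)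
  qed
  define v where "v = stretch X (w k) (j k)"
  have card: "card (UNIV - {j k}) = 3" by (simp add: card_Diff_subset)
  have w1: "\<bar>w k l\<bar> = 1" for l using wj(1) by (simp add: sign_vector_def)
  have norm: "(\<Sum>l\<in>UNIV. \<bar>v l\<bar>) = X + 3"
    using X1 card w1 unfolding v_def stretch_def
    by (simp add: sum.remove[of UNIV "j k"] abs_mult cong: sum.cong_simp)
  have "\<bar>dot (T i) v\<bar> \<le> (X + 3) / 2" for i
  proof (cases "i = k")
    case True
    have aw: "T k (j k) * w k (j k) = - s"
      using wj(4)[of k] w1[of "j k"] unfolding s_def
      by (metis abs_mult abs_of_nonpos minus_minus mult.right_neutral)
    have "\<eta> = s + (3 - (\<Sum>l\<in>UNIV - {j k}. T k l * w k l))"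
      unfolding \<eta>_def dev_def deviation_def s_def by (simp add: sum_subtractf card)
    moreover have "dot (T k) (w k) = - s + (\<Sum>l\<in>UNIV - {j k}. T k l * w k l)"
      unfolding dot_def by (simp add: sum.remove[of UNIV "j k"] aw)
    ultimately have "dot (T k) v = 3 - (\<eta> - s) - X * s"
      unfolding v_def dot_stretch aw by (simp add: algebra_simps)
    moreover have "X * (1 + 2 * s) = 3 - 2 * (\<eta> - s)"
      unfolding X_def using s0 by simp
    ultimately have "dot (T k) v = (X + 3) / 2" by (simp add: algebra_simps)
    then show ?thesis using True X1 by simp
  next
    case False
    note nb = wj(5)[OF False] wj(6)[OF False]
    have dev_i: "deviation (T i) (w i) (j i) \<le> \<eta>"
      using k[of i] unfolding dev_def \<eta>_def .
    show ?thesis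
    proof (cases "j k = j i")
      case True
      show ?thesis unfolding v_def True
        by (rule stretched_same_coordinate_le[OF T wj(1) wj(1) dev_i \<eta> nb(1) X1 X3])
    next
      case False
      show ?thesis unfolding v_def
        by (rule stretched_other_coordinate_le[OF T wj(1) wj(1) dev_i \<eta> False nb X1 X3])
    qed
  qed
  then show thesis using X1 norm by (intro that[of v]) auto
qed

section \<open>The Hadamard matrix attains the distance\<close>

lemma sum_abs_hadamard_le:
  fixes a b c d :: real
  assumes "\<bar>a\<bar> \<le> 1" "\<bar>b\<bar> \<le> 1" "\<bar>c\<bar> \<le> 1" "\<bar>d\<bar> \<le> 1"
  shows "\<bar>a + b + c + d\<bar> + \<bar>a + b - c - d\<bar> + \<bar>a - b + c - d\<bar> + \<bar>a - b - c + d\<bar> \<le> 8"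
proof -
  have pair: "\<bar>s + t\<bar> + \<bar>s - t\<bar> \<le> 4" if "\<bar>s\<bar> \<le> 2" "\<bar>t\<bar> \<le> 2" for s t :: real
    using that by linarith
  have "\<bar>(a + b) + (c + d)\<bar> + \<bar>(a + b) - (c + d)\<bar> \<le> 4"
    using assms by (intro pair) linarith+
  moreover have "\<bar>(a - b) + (c - d)\<bar> + \<bar>(a - b) - (c - d)\<bar> \<le> 4"
    using assms by (intro pair) linarith+
  ultimately show ?thesis by (simp add: algebra_simps)
qed

definition hadamard :: "real ^ 4 ^ 4" where
  "hadamard = vector [vector [1, 1, 1, 1], vector [1, 1, -1, -1],
     vector [1, -1, 1, -1], vector [1, -1, -1, 1]]"

lemma vector_4:
  "(vector [a, b, c, d] :: 'a::zero ^ 4) $ 1 = a" "(vector [a, b, c, d] :: 'a ^ 4) $ 2 = b"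
  "(vector [a, b, c, d] :: 'a ^ 4) $ 3 = c" "(vector [a, b, c, d] :: 'a ^ 4) $ 4 = d"
  unfolding vector_def by simp_all

lemma hadamard_mult:
  "hadamard *v x = vector [x$1 + x$2 + x$3 + x$4, x$1 + x$2 - x$3 - x$4,
     x$1 - x$2 + x$3 - x$4, x$1 - x$2 - x$3 + x$4]"
  by (simp add: vec_eq_iff forall_4 matrix_vector_mult_def sum_4 hadamard_def vector_4)

lemma hadamard_hadamard: "hadamard *v (hadamard *v x) = 4 *\<^sub>R x"
  by (simp add: hadamard_mult vec_eq_iff forall_4 vector_4)

text \<open>
  Since the entries of the Hadamard matrix are \<open>\<plusminus>1\<close>, the map sends the cross-polytope into twice
  the cube. Its inverse is one eighth of the same matrix, so the other inclusion is
  \<open>sum_abs_hadamard_le\<close>.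
\<close>

lemma two_is_admissible:
  defines "T \<equiv> \<lambda>x. 2 *\<^sub>R (hadamard *v x)"
  shows "linear T" "bij T" "cube \<subseteq> T ` cross_polytope"
    "T ` cross_polytope \<subseteq> (\<lambda>x. 2 *\<^sub>R x) ` cube"
proof -
  show lin: "linear T"
    unfolding T_def by (intro linear_compose_scale_right matrix_vector_mul_linear)
  define S where "S = (\<lambda>x. (1 / 8) *\<^sub>R (hadamard *v x))"
  have TS: "T (S x) = x" for x
    by (simp add: T_def S_def hadamard_hadamard matrix_vector_mult_scaleR)
  have ST: "S (T x) = x" for x
    by (simp add: T_def S_def hadamard_hadamard matrix_vector_mult_scaleR)
  show "bij T" using TS ST by (intro o_bij[of S]) auto
  show "cube \<subseteq> T ` cross_polytope"
  proof
    fix x :: "real ^ 4" assume "x \<in> cube"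
    then have "\<bar>x $ i\<bar> \<le> 1" for i by (simp add: cube_def abs_le_iff)
    then have "S x \<in> cross_polytope"
      using sum_abs_hadamard_le[of "x$1" "x$2" "x$3" "x$4"]
      by (simp add: S_def cross_polytope_def sum_4 hadamard_mult vector_4 abs_mult)
    then show "x \<in> T ` cross_polytope" using TS[of x] by (metis imageI)
  qed
  show "T ` cross_polytope \<subseteq> (\<lambda>x. 2 *\<^sub>R x) ` cube"
  proof -
    have "hadamard *v y \<in> cube" if "y \<in> cross_polytope" for y
      using that unfolding cube_def cross_polytope_def
      by (simp add: hadamard_mult forall_4 sum_4 vector_4) linarith
    then show ?thesis unfolding T_def by blast
  qed
qed

section \<open>The lower bound\<close>

lemma uminus_mem_cube: "x \<in> cube \<Longrightarrow> - x \<in> cube"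
  by (force simp: cube_def)

lemma uminus_mem_cross_polytope: "x \<in> cross_polytope \<Longrightarrow> - x \<in> cross_polytope"
  by (simp add: cross_polytope_def)

lemma convex_cube: "convex (cube :: (real ^ 'n) set)"
  unfolding cube_def by (rule convex_box_cart) (simp only: Collect_mem_eq convex_real_interval)

lemma convex_cross_polytope: "convex (cross_polytope :: (real ^ 'n) set)"
proof (rule convexI)
  fix x y :: "real ^ 'n" and u v :: real
  assume *: "x \<in> cross_polytope" "y \<in> cross_polytope" "0 \<le> u" "0 \<le> v" "u + v = 1"
  have "(\<Sum>i\<in>UNIV. \<bar>u * x $ i + v * y $ i\<bar>) \<le> (\<Sum>i\<in>UNIV. u * \<bar>x $ i\<bar> + v * \<bar>y $ i\<bar>)"
    using * by (intro sum_mono order_trans[OF abs_triangle_ineq]) (simp add: abs_mult)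
  also have "\<dots> = u * (\<Sum>i\<in>UNIV. \<bar>x $ i\<bar>) + v * (\<Sum>i\<in>UNIV. \<bar>y $ i\<bar>)"
    by (simp add: sum.distrib sum_distrib_left)
  also have "\<dots> \<le> u * 1 + v * 1"
    using * by (intro add_mono mult_left_mono) (auto simp: cross_polytope_def)
  finally show "u *\<^sub>R x + v *\<^sub>R y \<in> cross_polytope"
    using * by (simp add: cross_polytope_def)
qed

text \<open>
  Subtract the inclusions for \<open>x\<close> and \<open>-x\<close>: the translations cancel, and \<open>x\<close> becomes the midpoint of
  two points of \<open>B\<close>.
\<close>

lemma symmetric_subset_untranslate:
  fixes A B :: "'a::real_vector set"
  assumes A: "\<And>x. x \<in> A \<Longrightarrow> - x \<in> A" and B: "\<And>y. y \<in> B \<Longrightarrow> - y \<in> B" "convex B"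
    and sub: "(\<lambda>x. x + a) ` A \<subseteq> (\<lambda>y. y + b) ` B"
  shows "A \<subseteq> B"
proof
  fix x assume x: "x \<in> A"
  obtain y where y: "y \<in> B" "x + a = y + b" using sub x by blast
  obtain y' where y': "y' \<in> B" "- x + a = y' + b" using sub A[OF x] by blast
  have "2 *\<^sub>R x = (x + a) - (- x + a)" by (simp add: scaleR_2)
  also have "\<dots> = y + (- y')" unfolding y(2) y'(2) by simp
  finally have "x = (1 / 2) *\<^sub>R (y + (- y'))"
    by (metis scaleR_half_double scaleR_2)
  also have "\<dots> = (1 / 2) *\<^sub>R y + (1 / 2) *\<^sub>R (- y')" by (rule scaleR_add_right)
  also have "\<dots> \<in> B" using B(2) y(1) B(1)[OF y'(1)] by (intro convexD) auto
  finally show "x \<in> B" .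
qed

text \<open>
  Let \<open>v\<close> be the vector that the matrix of \<open>T / r\<close> contracts by half, scaled to have \<open>\<ell>\<^sub>1\<close> norm
  \<open>2 / r\<close>. Then \<open>T v\<close> lies in the cube, so \<open>v\<close> lies in the cross-polytope, that is, \<open>2 / r \<le> 1\<close>.
\<close>

lemma centred_ratio_ge_2:
  fixes T :: "real ^ 4 \<Rightarrow> real ^ 4"
  assumes T: "linear T" "inj T" and r: "r > 0"
    and C: "cube \<subseteq> T ` cross_polytope" and P: "T ` cross_polytope \<subseteq> (\<lambda>x. r *\<^sub>R x) ` cube"
  shows "r \<ge> 2"
proof (rule ccontr)
  assume "\<not> 2 \<le> r"
  define M where "M i j = T (axis j 1) $ i / r" for i j
  have M: "\<forall>j. \<bar>M i j\<bar> \<le> 1" for i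
  proof
    fix j :: 4
    have "(axis j 1 :: real ^ 4) \<in> cross_polytope"
      by (simp add: cross_polytope_def axis_def if_distrib[of abs] cong: if_cong)
    then obtain z :: "real ^ 4" where "z \<in> cube" "T (axis j 1) = r *\<^sub>R z" using P by blast
    then show "\<bar>M i j\<bar> \<le> 1" using r by (simp add: M_def cube_def abs_le_iff)
  qed
  obtain v where v: "(\<Sum>j\<in>UNIV. \<bar>v j\<bar>) > 0" "\<And>i. \<bar>dot (M i) v\<bar> \<le> (\<Sum>j\<in>UNIV. \<bar>v j\<bar>) / 2"
    by (rule exists_vector_half_norm[of M, OF M]) (rule that)
  define N where "N = (\<Sum>j\<in>UNIV. \<bar>v j\<bar>)"
  define y :: "real ^ 4" where "y = (\<chi> j. 2 / (r * N) * v j)"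
  have Ty: "T x $ i = r * dot (M i) (\<lambda>j. x $ j)" for x i
  proof -
    have "T x $ i = (matrix T *v x) $ i" by (simp add: matrix_vector_mul(2)[OF T(1)])
    also have "\<dots> = (\<Sum>j\<in>UNIV. T (axis j 1) $ i * x $ j)"
      by (simp add: matrix_vector_mult_def matrix_def)
    also have "\<dots> = (\<Sum>j\<in>UNIV. r * (M i j * x $ j))"
      using r by (intro sum.cong) (auto simp: M_def)
    finally show ?thesis by (simp add: dot_def sum_distrib_left)
  qed
  have "T y \<in> cube"
  proof -
    have "\<bar>T y $ i\<bar> \<le> 1" for i
    proof -
      have "T y $ i = 2 / N * dot (M i) v"
        using r v(1) unfolding Ty dot_def y_def
        by (simp add: sum_distrib_left N_def[symmetric] field_simps)
      then have "\<bar>T y $ i\<bar> = 2 / N * \<bar>dot (M i) v\<bar>"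
        using v(1) by (simp add: abs_mult N_def)
      also have "\<dots> \<le> 2 / N * (N / 2)"
        using v unfolding N_def by (intro mult_left_mono) auto
      finally show ?thesis using v(1) by (simp add: N_def)
    qed
    then show ?thesis by (simp add: cube_def abs_le_iff minus_le_iff)
  qed
  then have "y \<in> cross_polytope" using C T(2) by (auto dest: injD)
  moreover have "(\<Sum>j\<in>UNIV. \<bar>y $ j\<bar>) = 2 / r"
  proof -
    have "(\<Sum>j\<in>UNIV. \<bar>y $ j\<bar>) = (\<Sum>j\<in>UNIV. 2 / (r * N) * \<bar>v j\<bar>)"
      using r v(1) unfolding y_def by (simp add: abs_mult N_def)
    also have "\<dots> = 2 / (r * N) * N" unfolding N_def by (rule sum_distrib_left[symmetric])
    finally show ?thesis using v(1) by (simp add: N_def)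
  qed
  ultimately show False using r \<open>\<not> 2 \<le> r\<close> by (simp add: cross_polytope_def field_simps)
qed

theorem theorem3p1:
  shows "banach_mazur (cube :: (real ^ 4) set) (cross_polytope :: (real ^ 4) set) = 2"
  unfolding banach_mazur_def
proof (rule cInf_eq_minimum)
  let ?C = "cube :: (real ^ 4) set" and ?P = "cross_polytope :: (real ^ 4) set"
  let ?R = "{r. r > 0 \<and> (\<exists>T u v. linear T \<and> bij T \<and>
      (\<lambda>x. x + u) ` ?C \<subseteq> T ` (\<lambda>x. x + v) ` ?P \<and>
      T ` (\<lambda>x. x + v) ` ?P \<subseteq> (\<lambda>x. r *\<^sub>R x) ` (\<lambda>x. x + u) ` ?C)}"
  show "2 \<in> ?R"
    by (rule CollectI, rule conjI, simp, rule exI[of _ "\<lambda>x. 2 *\<^sub>R (hadamard *v x)"],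
        rule exI[of _ 0], rule exI[of _ 0])
      (use two_is_admissible in simp)
  fix r :: real
  assume "r \<in> ?R"
  then obtain T :: "real ^ 4 \<Rightarrow> real ^ 4" and u v where r: "r > 0" and T: "linear T" "bij T"
    and 1: "(\<lambda>x. x + u) ` cube \<subseteq> T ` (\<lambda>x. x + v) ` cross_polytope"
    and 2: "T ` (\<lambda>x. x + v) ` cross_polytope \<subseteq> (\<lambda>x. r *\<^sub>R x) ` (\<lambda>x. x + u) ` cube"
    by (elim CollectE exE conjE) (rule that)
  interpret T: linear T by fact
  have TP: "T ` (\<lambda>x. x + v) ` cross_polytope = (\<lambda>y. y + T v) ` T ` cross_polytope"
    by (simp add: image_image T.add)
  have rC: "(\<lambda>x. r *\<^sub>R x) ` (\<lambda>x. x + u) ` cube = (\<lambda>z. z + r *\<^sub>R u) ` (\<lambda>x. r *\<^sub>R x) ` cube"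
    by (simp add: image_image scaleR_add_right)
  have symP: "- y \<in> T ` cross_polytope" if "y \<in> T ` cross_polytope" for y
  proof -
    obtain x where "x \<in> cross_polytope" "y = T x" using \<open>y \<in> T ` cross_polytope\<close> by blast
    then show ?thesis
      using T.neg[of x] by (intro image_eqI[of _ _ "- x"] uminus_mem_cross_polytope) simp_all
  qed
  have symC: "- z \<in> (\<lambda>x. r *\<^sub>R x) ` cube" if "z \<in> (\<lambda>x. r *\<^sub>R x) ` cube" for z :: "real ^ 4"
  proof -
    obtain x :: "real ^ 4" where "x \<in> cube" "z = r *\<^sub>R x"
      using \<open>z \<in> (\<lambda>x. r *\<^sub>R x) ` cube\<close> by blast
    then show ?thesis by (intro image_eqI[of _ _ "- x"] uminus_mem_cube) simp_all
  qed
  have "cube \<subseteq> T ` cross_polytope"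
    using symmetric_subset_untranslate[OF uminus_mem_cube symP _ 1[unfolded TP]]
      convex_linear_image[OF T(1) convex_cross_polytope] by blast
  moreover have "T ` cross_polytope \<subseteq> (\<lambda>x. r *\<^sub>R x) ` cube"
    using symmetric_subset_untranslate[OF symP symC _ 2[unfolded TP rC]]
      convex_scaling[OF convex_cube] by blast
  ultimately show "2 \<le> r"
    using centred_ratio_ge_2[OF T(1) bij_is_inj[OF T(2)] r] by blast
qed

end
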